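(* Let $D\neq\{1\}$ and $Q$ be groups, let $\Omega$ be a $Q$-set, and let $G=D\wr_{\Omega}Q$ be the complete (unrestricted) wreath product. A necessary and sufficient condition for $G$ to be icc is that, on the one hand, at least one of the following conditions holds: (i.a) $D$ is icc; (i.b) all $Q$-orbits in $\Omega$ are infinite; and, on the other hand, the two following conditions hold: (ii) $1$ is the only element of $FC(Q)$ which fixes $\Omega$ pointwise; (iii) $D$ is centerless, i.e. has trivial center.
   Context: A group is icc if it is infinite and all of its conjugacy classes except $\{1\}$ are infinite. A $Q$-set is a set equipped with a left $Q$-action. The complete (or unrestricted) wreath product $D\wr_{\Omega}Q$ is the semi-direct product $D^{\Omega}\rtimes Q$, where $D^{\Omega}$ is the group (under pointwise multiplication) of all maps $\phi:\Omega\to D$, and $q\in Q$ acts by $(q\phi q^{-1})(x)=\phi(q^{-1}x)$ for all $x\in\Omega$. $FC(Q)$ is the union of the finite conjugacy classes of $Q$, which is a characteristic subgroup of $Q$.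
   Formalization: The set Ω is assumed nonempty; for empty Ω the claim fails, since then G = Q, and with D = Z/2 and Q icc, G is icc although D is not centerless. *)

theory Defs
  imports "HOL-Algebra.Algebra"
begin

definition conj_class :: "('a, 'm) monoid_scheme \<Rightarrow> 'a \<Rightarrow> 'a set"
  where "conj_class G x = {g \<otimes>\<^bsub>G\<^esub> x \<otimes>\<^bsub>G\<^esub> inv\<^bsub>G\<^esub> g | g. g \<in> carrier G}"

definition icc :: "('a, 'm) monoid_scheme \<Rightarrow> bool"
  where "icc G \<longleftrightarrow> infinite (carrier G) \<and>
           (\<forall>x \<in> carrier G. conj_class G x \<noteq> {\<one>\<^bsub>G\<^esub>} \<longrightarrow> infinite (conj_class G x))"

definition FC :: "('a, 'm) monoid_scheme \<Rightarrow> 'a set"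
  where "FC G = \<Union>{C. \<exists>x \<in> carrier G. C = conj_class G x \<and> finite C}"

definition group_center :: "('a, 'm) monoid_scheme \<Rightarrow> 'a set"
  where "group_center G = {z \<in> carrier G. \<forall>g \<in> carrier G. z \<otimes>\<^bsub>G\<^esub> g = g \<otimes>\<^bsub>G\<^esub> z}"

text \<open>In the following product, \<open>(n, h)\<close> stands for the product \<open>n h\<close>, and
  \<open>\<theta> h n\<close> for the conjugate \<open>h n h\<^sup>-\<^sup>1\<close>.\<close>

definition semidirect_product ::
  "('a, 'm) monoid_scheme \<Rightarrow> ('b, 'n) monoid_scheme \<Rightarrow> ('b \<Rightarrow> 'a \<Rightarrow> 'a) \<Rightarrow> ('a \<times> 'b) monoid"
  where "semidirect_product N H \<theta> =
    \<lparr>carrier = carrier N \<times> carrier H,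
     monoid.mult = (\<lambda>(n, h) (m, k). (n \<otimes>\<^bsub>N\<^esub> \<theta> h m, h \<otimes>\<^bsub>H\<^esub> k)),
     one = (\<one>\<^bsub>N\<^esub>, \<one>\<^bsub>H\<^esub>)\<rparr>"

definition translate ::
  "('q, 'm) monoid_scheme \<Rightarrow> 'x set \<Rightarrow> ('q \<Rightarrow> 'x \<Rightarrow> 'x) \<Rightarrow> 'q \<Rightarrow> ('x \<Rightarrow> 'd) \<Rightarrow> ('x \<Rightarrow> 'd)"
  where "translate Q \<Omega> act q \<phi> = (\<lambda>x\<in>\<Omega>. \<phi> (act (inv\<^bsub>Q\<^esub> q) x))"

definition complete_wreath_product ::
  "('d, 'm) monoid_scheme \<Rightarrow> ('q, 'n) monoid_scheme \<Rightarrow> 'x set \<Rightarrow> ('q \<Rightarrow> 'x \<Rightarrow> 'x)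
     \<Rightarrow> (('x \<Rightarrow> 'd) \<times> 'q) monoid"
  where "complete_wreath_product D Q \<Omega> act =
    semidirect_product (product_group \<Omega> (\<lambda>_. D)) Q (translate Q \<Omega> act)"

lemma group_complete_wreath_product:
  assumes D: "group D" and act: "group_action Q \<Omega> act"
  shows "group (complete_wreath_product D Q \<Omega> act)"
proof -
  interpret D: group D by (rule D)
  interpret A: group_action Q \<Omega> act by (rule act)
  interpret Q: group Q using A.group_hom by (simp add: group_hom_def)
  have act_in: "act q x \<in> \<Omega>" if "q \<in> carrier Q" "x \<in> \<Omega>" for q x
    using A.element_image that by blast
  have act1: "act \<one>\<^bsub>Q\<^esub> x = x" if "x \<in> \<Omega>" for x
    using that by (simp flip: A.id_eq_one)
  have actm: "act (q \<otimes>\<^bsub>Q\<^esub> r) x = act q (act r x)"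
    if "q \<in> carrier Q" "r \<in> carrier Q" "x \<in> \<Omega>" for q r x
    using A.composition_rule that by blast
  show ?thesis
    unfolding complete_wreath_product_def semidirect_product_def
  proof (rule groupI, goal_cases)
    case (1 x y)
    then show ?case
      by (auto simp: translate_def PiE_iff act_in)
  next
    case 2
    then show ?case by auto
  next
    case (3 x y z)
    then show ?case
      by (auto simp: translate_def PiE_iff act_in actm Q.inv_mult_group Q.m_assoc D.m_assoc
               intro!: restrict_ext)
  next
    case (4 x)
    then show ?case
      by (fastforce simp: translate_def PiE_iff act1 extensional_def fun_eq_iff)
  next
    case (5 x)
    then obtain f q where x: "x = (f, q)" "f \<in> (\<Omega> \<rightarrow>\<^sub>E carrier D)" "q \<in> carrier Q"
      by auto
    show ?case
      by (rule bexI[of _ "((\<lambda>x\<in>\<Omega>. inv\<^bsub>D\<^esub> f (act q x)), inv\<^bsub>Q\<^esub> q)"])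
        (use x in \<open>auto simp: translate_def PiE_iff act_in intro!: restrict_ext D.l_inv\<close>)
  qed
qed

lemma complete_wreath_product_conj:
  fixes G :: "(('x \<Rightarrow> 'd) \<times> 'q) monoid"
  assumes D: "group D" and act: "group_action Q \<Omega> act"
    and q: "q \<in> carrier Q" and \<phi>: "\<phi> \<in> (\<Omega> \<rightarrow>\<^sub>E carrier D)"
  defines "G \<equiv> complete_wreath_product D Q \<Omega> act"
  defines "\<iota> \<equiv> (\<lambda>x\<in>\<Omega>. \<one>\<^bsub>D\<^esub>)"
  shows "(\<iota>, q) \<otimes>\<^bsub>G\<^esub> (\<phi>, \<one>\<^bsub>Q\<^esub>) \<otimes>\<^bsub>G\<^esub> inv\<^bsub>G\<^esub> (\<iota>, q)
           = ((\<lambda>x\<in>\<Omega>. \<phi> (act (inv\<^bsub>Q\<^esub> q) x)), \<one>\<^bsub>Q\<^esub>)"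
proof -
  interpret D: group D by (rule D)
  interpret A: group_action Q \<Omega> act by (rule act)
  interpret Q: group Q using A.group_hom by (simp add: group_hom_def)
  interpret G: group G unfolding G_def by (rule group_complete_wreath_product[OF D act])
  have act_in: "act q x \<in> \<Omega>" if "q \<in> carrier Q" "x \<in> \<Omega>" for q x
    using A.element_image that by blast
  have mem: "\<phi> (act (inv\<^bsub>Q\<^esub> q) x) \<in> carrier D" if "x \<in> \<Omega>" for x
    using \<phi> act_in[of "inv\<^bsub>Q\<^esub> q" x] that q by auto
  have inv: "inv\<^bsub>G\<^esub> (\<iota>, q) = (\<iota>, inv\<^bsub>Q\<^esub> q)"
    by (rule G.inv_equality)
      (use q in \<open>auto simp: G_def \<iota>_def complete_wreath_product_def semidirect_product_def
         translate_def act_in intro!: restrict_ext\<close>)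
  show ?thesis
    unfolding inv using q mem
    by (auto simp: G_def \<iota>_def complete_wreath_product_def semidirect_product_def
         translate_def act_in intro!: restrict_ext)
qed

end

theory Submission
  imports Defs
begin

text \<open>Sufficiency: let \<open>g = (\<phi>, q) \<noteq> 1\<close> have a finite conjugacy class. Then \<open>q \<in> FC Q\<close>, and
  conditions (ii) and (iii) yield \<open>x\<^sub>0 \<in> \<Omega>\<close> and \<open>d \<in> D\<close> such that conjugating \<open>g\<close> by the function \<open>\<delta>\<close>
  with value \<open>d\<close> at \<open>x\<^sub>0\<close> and trivial elsewhere changes the value at \<open>x\<^sub>0\<close>. The elements \<open>g\<close> and
  \<open>\<delta> g \<delta>\<^sup>-\<^sup>1\<close> disagree at finitely many points only, one of them being \<open>x\<^sub>0\<close>, and the conjugates of this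
  pair by \<open>r \<in> Q\<close> disagree at \<open>r x\<^sub>0\<close>; as there are finitely many pairs in the class, the orbit of
  \<open>x\<^sub>0\<close> is finite. Letting \<open>d\<close> vary, the values at \<open>x\<^sub>0\<close> show that \<open>D\<close> has a nontrivial finite class.
  Necessity: a violation of any of the conditions gives an explicit nontrivial finite class.\<close>

section \<open>Conjugacy classes, \<open>FC\<close> and the icc property in an arbitrary
  group\<close>

context group
begin

lemma conj_class_subset_carrier:
  "x \<in> carrier G \<Longrightarrow> conj_class G x \<subseteq> carrier G"
  by (auto simp: conj_class_def)

lemma conj_class_self: "x \<in> carrier G \<Longrightarrow> x \<in> conj_class G x"
  unfolding conj_class_def by (intro CollectI exI[of _ \<one>]) simp

lemma conj_class_eq_one_iff:
  assumes "x \<in> carrier G"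
  shows "conj_class G x = {\<one>} \<longleftrightarrow> x = \<one>"
proof
  assume "x = \<one>"
  then show "conj_class G x = {\<one>}"
    using conj_class_self[OF assms] by (auto simp: conj_class_def)
qed (use conj_class_self[OF assms] in auto)

lemma conj_class_conj_subset:
  assumes "x \<in> carrier G" "y \<in> conj_class G x"
  shows "conj_class G y \<subseteq> conj_class G x"
proof
  fix z assume "z \<in> conj_class G y"
  then obtain g h where gh: "g \<in> carrier G" "h \<in> carrier G" "z = g \<otimes> (h \<otimes> x \<otimes> inv h) \<otimes> inv g"
    using assms by (auto simp: conj_class_def)
  then have "z = (g \<otimes> h) \<otimes> x \<otimes> inv (g \<otimes> h)"
    using assms by (simp add: m_assoc inv_mult_group)
  then show "z \<in> conj_class G x"
    using gh by (auto simp: conj_class_def)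
qed

text \<open>A member of a finite class has its own class inside that class, so membership in the
  union defining \<open>FC\<close> can be tested on the element itself.\<close>

lemma mem_FC_iff: "q \<in> FC G \<longleftrightarrow> q \<in> carrier G \<and> finite (conj_class G q)"
proof
  assume "q \<in> FC G"
  then obtain x where x: "x \<in> carrier G" "finite (conj_class G x)" "q \<in> conj_class G x"
    by (auto simp: FC_def)
  show "q \<in> carrier G \<and> finite (conj_class G q)"
    using x conj_class_subset_carrier[OF x(1)] finite_subset[OF conj_class_conj_subset[OF x(1,3)]] by auto
next
  assume "q \<in> carrier G \<and> finite (conj_class G q)"
  then show "q \<in> FC G"
    using conj_class_self[of q] by (auto simp: FC_def)
qed

text \<open>If only the identity has a finite class, any other element has an infinite class inside
  the carrier, which is then infinite. Hence the cardinality clause of \<open>icc\<close> needs no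
  separate treatment. The trivial group satisfies the right-hand side but is finite, so it must be
  excluded.\<close>

lemma icc_iff_if_nontrivial:
  assumes "carrier G \<noteq> {\<one>}"
  shows "icc G \<longleftrightarrow> (\<forall>x\<in>carrier G. finite (conj_class G x) \<longrightarrow> x = \<one>)"
proof
  assume *: "\<forall>x\<in>carrier G. finite (conj_class G x) \<longrightarrow> x = \<one>"
  obtain x where "x \<in> carrier G" "x \<noteq> \<one>"
    using assms one_closed by blast
  with * have "infinite (carrier G)"
    using conj_class_subset_carrier finite_subset by blast
  with * show "icc G"
    using conj_class_eq_one_iff by (auto simp: icc_def)
qed (auto simp: icc_def conj_class_eq_one_iff)

end

section \<open>The wreath product and an explicit formula for conjugation in it\<close>

locale wreath_setting = D: group D + Q: group Q + A: group_action Q \<Omega> act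
  for D :: "('d, 'm) monoid_scheme" and Q :: "('q, 'n) monoid_scheme"
    and \<Omega> :: "'x set" and act :: "'q \<Rightarrow> 'x \<Rightarrow> 'x" +
  assumes D_nontrivial: "carrier D \<noteq> {\<one>\<^bsub>D\<^esub>}"
    and \<Omega>_nonempty: "\<Omega> \<noteq> {}"
begin

abbreviation W where "W \<equiv> complete_wreath_product D Q \<Omega> act"

sublocale W: group W
  by (rule group_complete_wreath_product) unfold_locales

lemma act_in [simp]: "q \<in> carrier Q \<Longrightarrow> x \<in> \<Omega> \<Longrightarrow> act q x \<in> \<Omega>"
  using A.element_image by blast

lemma act_one [simp]: "x \<in> \<Omega> \<Longrightarrow> act \<one>\<^bsub>Q\<^esub> x = x"
  by (simp flip: A.id_eq_one)

lemma act_mult [simp]: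
  "q \<in> carrier Q \<Longrightarrow> r \<in> carrier Q \<Longrightarrow> x \<in> \<Omega> \<Longrightarrow> act (q \<otimes>\<^bsub>Q\<^esub> r) x = act q (act r x)"
  using A.composition_rule by blast

lemma act_inv_act [simp]:
  assumes "q \<in> carrier Q" "x \<in> \<Omega>"
  shows "act (inv\<^bsub>Q\<^esub> q) (act q x) = x" "act q (act (inv\<^bsub>Q\<^esub> q) x) = x"
  using assms act_mult[of "inv\<^bsub>Q\<^esub> q" q x] act_mult[of q "inv\<^bsub>Q\<^esub> q" x] by auto

lemma carrier_W: "carrier W = (\<Omega> \<rightarrow>\<^sub>E carrier D) \<times> carrier Q"
  by (simp add: complete_wreath_product_def semidirect_product_def)

lemma one_W: "\<one>\<^bsub>W\<^esub> = ((\<lambda>x\<in>\<Omega>. \<one>\<^bsub>D\<^esub>), \<one>\<^bsub>Q\<^esub>)"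
  by (simp add: complete_wreath_product_def semidirect_product_def)

lemma mult_W:
  assumes "\<psi> \<in> \<Omega> \<rightarrow>\<^sub>E carrier D" "r \<in> carrier Q"
  shows "(\<psi>, r) \<otimes>\<^bsub>W\<^esub> (\<phi>, q) = ((\<lambda>x\<in>\<Omega>. \<psi> x \<otimes>\<^bsub>D\<^esub> \<phi> (act (inv\<^bsub>Q\<^esub> r) x)), r \<otimes>\<^bsub>Q\<^esub> q)"
  using assms
  by (auto simp: complete_wreath_product_def semidirect_product_def translate_def intro!: restrict_ext)

text \<open>Both standing assumptions enter here: for empty \<Omega> the wreath product is a copy of
  \<open>Q\<close>, which may be trivial and carries no information about \<open>D\<close>.\<close>

lemma W_nontrivial: "carrier W \<noteq> {\<one>\<^bsub>W\<^esub>}"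
proof -
  obtain d x where d: "d \<in> carrier D" "d \<noteq> \<one>\<^bsub>D\<^esub>" "x \<in> \<Omega>"
    using D_nontrivial \<Omega>_nonempty D.one_closed by blast
  have "((\<lambda>x\<in>\<Omega>. d), \<one>\<^bsub>Q\<^esub>) \<in> carrier W"
    using d by (auto simp: carrier_W)
  moreover have "((\<lambda>x\<in>\<Omega>. d), \<one>\<^bsub>Q\<^esub>) \<noteq> \<one>\<^bsub>W\<^esub>"
    using d by (auto simp: one_W fun_eq_iff)
  ultimately show ?thesis by blast
qed

lemmas icc_D_iff = D.icc_iff_if_nontrivial[OF D_nontrivial]
lemmas icc_W_iff = W.icc_iff_if_nontrivial[OF W_nontrivial]

text \<open>First component of the conjugate of (\<phi>, q) by (\<psi>, r). The argument of the last
  factor is x moved by the inverse of r q r^-1; it is written as nested actions so that the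
  simplification rules for \<open>act\<close> apply to it directly.\<close>

definition conj_fun :: "('x \<Rightarrow> 'd) \<Rightarrow> 'q \<Rightarrow> ('x \<Rightarrow> 'd) \<Rightarrow> 'q \<Rightarrow> 'x \<Rightarrow> 'd" where
  "conj_fun \<psi> r \<phi> q = (\<lambda>x\<in>\<Omega>. \<psi> x \<otimes>\<^bsub>D\<^esub> \<phi> (act (inv\<^bsub>Q\<^esub> r) x) \<otimes>\<^bsub>D\<^esub>
     inv\<^bsub>D\<^esub> \<psi> (act r (act (inv\<^bsub>Q\<^esub> q) (act (inv\<^bsub>Q\<^esub> r) x))))"

lemma conj_W:
  assumes \<psi>: "\<psi> \<in> \<Omega> \<rightarrow>\<^sub>E carrier D" and r: "r \<in> carrier Q"
    and \<phi>: "\<phi> \<in> \<Omega> \<rightarrow>\<^sub>E carrier D" and q: "q \<in> carrier Q"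
  shows "(\<psi>, r) \<otimes>\<^bsub>W\<^esub> (\<phi>, q) \<otimes>\<^bsub>W\<^esub> inv\<^bsub>W\<^esub> (\<psi>, r) =
    (conj_fun \<psi> r \<phi> q, r \<otimes>\<^bsub>Q\<^esub> q \<otimes>\<^bsub>Q\<^esub> inv\<^bsub>Q\<^esub> r)"
    (is "_ = ?c")
proof -
  have val: "\<psi> x \<in> carrier D" "\<phi> x \<in> carrier D" if "x \<in> \<Omega>" for x
    using \<psi> \<phi> that by auto
  have cf: "conj_fun \<psi> r \<phi> q \<in> \<Omega> \<rightarrow>\<^sub>E carrier D"
    using r q val by (auto simp: conj_fun_def)
  \<comment> \<open>The inverse of (\<psi>, r) is never computed: it suffices that the claimed
    conjugate times (\<psi>, r) equals (\<psi>, r) times (\<phi>, q).\<close>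
  have "conj_fun \<psi> r \<phi> q x \<otimes>\<^bsub>D\<^esub> \<psi> (act (inv\<^bsub>Q\<^esub> (r \<otimes>\<^bsub>Q\<^esub> q \<otimes>\<^bsub>Q\<^esub> inv\<^bsub>Q\<^esub> r)) x) =
      \<psi> x \<otimes>\<^bsub>D\<^esub> \<phi> (act (inv\<^bsub>Q\<^esub> r) x)" if x: "x \<in> \<Omega>" for x
  proof -
    let ?y = "act r (act (inv\<^bsub>Q\<^esub> q) (act (inv\<^bsub>Q\<^esub> r) x))"
    have "inv\<^bsub>Q\<^esub> (r \<otimes>\<^bsub>Q\<^esub> q \<otimes>\<^bsub>Q\<^esub> inv\<^bsub>Q\<^esub> r) = r \<otimes>\<^bsub>Q\<^esub> (inv\<^bsub>Q\<^esub> q \<otimes>\<^bsub>Q\<^esub> inv\<^bsub>Q\<^esub> r)"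
      using r q by (simp add: Q.inv_mult_group)
    then have "act (inv\<^bsub>Q\<^esub> (r \<otimes>\<^bsub>Q\<^esub> q \<otimes>\<^bsub>Q\<^esub> inv\<^bsub>Q\<^esub> r)) x = ?y"
      using r q x by simp
    moreover have "\<psi> ?y \<in> carrier D" "\<psi> x \<in> carrier D" "\<phi> (act (inv\<^bsub>Q\<^esub> r) x) \<in> carrier D"
      using r q x by (simp_all add: val)
    ultimately show ?thesis
      using x by (simp add: conj_fun_def D.m_assoc)
  qed
  moreover have "r \<otimes>\<^bsub>Q\<^esub> q \<otimes>\<^bsub>Q\<^esub> inv\<^bsub>Q\<^esub> r \<otimes>\<^bsub>Q\<^esub> r = r \<otimes>\<^bsub>Q\<^esub> q"
    using r q by (simp add: Q.m_assoc)
  ultimately have "?c \<otimes>\<^bsub>W\<^esub> (\<psi>, r) = (\<psi>, r) \<otimes>\<^bsub>W\<^esub> (\<phi>, q)"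
    using r q by (simp add: mult_W[OF cf] mult_W[OF \<psi> r] cong: restrict_cong)
  moreover have "?c \<in> carrier W" "(\<psi>, r) \<in> carrier W" "(\<phi>, q) \<in> carrier W"
    using cf r q \<psi> \<phi> by (auto simp: carrier_W)
  ultimately show ?thesis
    by (metis W.inv_solve_right W.m_closed)
qed

lemma conj_class_W:
  assumes "\<phi> \<in> \<Omega> \<rightarrow>\<^sub>E carrier D" "q \<in> carrier Q"
  shows "conj_class W (\<phi>, q) = {(conj_fun \<psi> r \<phi> q, r \<otimes>\<^bsub>Q\<^esub> q \<otimes>\<^bsub>Q\<^esub> inv\<^bsub>Q\<^esub> r) |
    \<psi> r. \<psi> \<in> \<Omega> \<rightarrow>\<^sub>E carrier D \<and> r \<in> carrier Q}"
proof -
  have "conj_class W (\<phi>, q) = {(\<psi>, r) \<otimes>\<^bsub>W\<^esub> (\<phi>, q) \<otimes>\<^bsub>W\<^esub> inv\<^bsub>W\<^esub> (\<psi>, r) |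
    \<psi> r. \<psi> \<in> \<Omega> \<rightarrow>\<^sub>E carrier D \<and> r \<in> carrier Q}"
    unfolding conj_class_def carrier_W by blast
  also have "\<dots> = {(conj_fun \<psi> r \<phi> q, r \<otimes>\<^bsub>Q\<^esub> q \<otimes>\<^bsub>Q\<^esub> inv\<^bsub>Q\<^esub> r) |
    \<psi> r. \<psi> \<in> \<Omega> \<rightarrow>\<^sub>E carrier D \<and> r \<in> carrier Q}"
    by (intro Collect_cong ex_cong1 rev_conj_cong) (auto simp: conj_W[OF _ _ assms])
  finally show ?thesis .
qed

section \<open>Necessity of the three conditions\<close>

lemma center_trivial_if_icc:
  assumes "icc W"
  shows "group_center D = {\<one>\<^bsub>D\<^esub>}"
proof -
  have "z = \<one>\<^bsub>D\<^esub>" if z: "z \<in> carrier D" "\<And>g. g \<in> carrier D \<Longrightarrow> z \<otimes>\<^bsub>D\<^esub> g = g \<otimes>\<^bsub>D\<^esub> z" for z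
  proof -
    have mem: "(\<lambda>x\<in>\<Omega>. z) \<in> \<Omega> \<rightarrow>\<^sub>E carrier D"
      using z by auto
    \<comment> \<open>A constant function is unchanged by translation, and a central value is
      unchanged by pointwise conjugation. So the element (z, 1) has a one-element class.\<close>
    have "conj_fun \<psi> r (\<lambda>x\<in>\<Omega>. z) \<one>\<^bsub>Q\<^esub> = (\<lambda>x\<in>\<Omega>. z)"
      if "\<psi> \<in> \<Omega> \<rightarrow>\<^sub>E carrier D" "r \<in> carrier Q" for \<psi> r
      unfolding conj_fun_def
    proof (rule restrict_ext)
      fix x assume "x \<in> \<Omega>"
      with that have "\<psi> x \<in> carrier D" by auto
      then have "\<psi> x \<otimes>\<^bsub>D\<^esub> z \<otimes>\<^bsub>D\<^esub> inv\<^bsub>D\<^esub> \<psi> x = z"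
        using z by (simp flip: z(2) add: D.m_assoc)
      with \<open>x \<in> \<Omega>\<close> that show "\<psi> x \<otimes>\<^bsub>D\<^esub> (\<lambda>x\<in>\<Omega>. z) (act (inv\<^bsub>Q\<^esub> r) x) \<otimes>\<^bsub>D\<^esub>
          inv\<^bsub>D\<^esub> \<psi> (act r (act (inv\<^bsub>Q\<^esub> \<one>\<^bsub>Q\<^esub>) (act (inv\<^bsub>Q\<^esub> r) x))) = z"
        by simp
    qed
    then have "conj_class W ((\<lambda>x\<in>\<Omega>. z), \<one>\<^bsub>Q\<^esub>) \<subseteq> {((\<lambda>x\<in>\<Omega>. z), \<one>\<^bsub>Q\<^esub>)}"
      by (auto simp: conj_class_W[OF mem])
    then have "((\<lambda>x\<in>\<Omega>. z), \<one>\<^bsub>Q\<^esub>) = \<one>\<^bsub>W\<^esub>"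
      using assms mem by (auto simp: icc_W_iff carrier_W dest!: finite_subset)
    then show ?thesis
      using \<Omega>_nonempty by (auto simp: one_W fun_eq_iff split: if_splits)
  qed
  then show ?thesis
    by (auto simp: group_center_def)
qed

text \<open>When q acts trivially, the first component of any conjugate of (1, q) is \<psi>(x)
  \<psi>(x)^-1 = 1. The class of (1, q) is therefore no larger than the class of q in
  \<open>Q\<close>.\<close>

lemma FC_kernel_trivial_if_icc:
  assumes "icc W"
  shows "{q \<in> FC Q. \<forall>x \<in> \<Omega>. act q x = x} = {\<one>\<^bsub>Q\<^esub>}"
proof -
  let ?\<iota> = "\<lambda>x\<in>\<Omega>. \<one>\<^bsub>D\<^esub>"
  have "q = \<one>\<^bsub>Q\<^esub>" if q: "q \<in> carrier Q" "finite (conj_class Q q)" "\<And>x. x \<in> \<Omega> \<Longrightarrow> act q x = x" for q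
  proof -
    have mem: "?\<iota> \<in> \<Omega> \<rightarrow>\<^sub>E carrier D"
      by auto
    have qi: "act (inv\<^bsub>Q\<^esub> q) x = x" if "x \<in> \<Omega>" for x
      using act_inv_act(1)[of q x] q that by simp
    have "conj_fun \<psi> r ?\<iota> q = ?\<iota>" if "\<psi> \<in> \<Omega> \<rightarrow>\<^sub>E carrier D" "r \<in> carrier Q" for \<psi> r
      unfolding conj_fun_def using that q by (intro restrict_ext) (force simp: qi dest: PiE_mem)
    then have "conj_class W (?\<iota>, q) \<subseteq> {?\<iota>} \<times> conj_class Q q"
      unfolding conj_class_W[OF mem q(1)] by (auto simp: conj_class_def)
    then have "finite (conj_class W (?\<iota>, q))"
      using q(2) by (auto dest: finite_subset)
    then show ?thesis
      using assms mem q(1) by (auto simp: icc_W_iff carrier_W one_W)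
  qed
  then show ?thesis
    by (auto simp: Q.mem_FC_iff Q.conj_class_eq_one_iff[THEN iffD2])
qed

text \<open>Applying r or its inverse stays within an orbit. The equivalence is what makes a
  function that is constant on C and trivial off C invariant under translation.\<close>

lemma orbit_memD:
  assumes "C \<in> orbits Q \<Omega> act"
  shows "C \<subseteq> \<Omega>" "C \<noteq> {}"
    and "\<And>r x. r \<in> carrier Q \<Longrightarrow> x \<in> \<Omega> \<Longrightarrow> act r x \<in> C \<longleftrightarrow> x \<in> C"
proof -
  obtain y where y: "y \<in> \<Omega>" and C: "C = {act g y | g. g \<in> carrier Q}"
    using assms by (auto simp: orbits_def orbit_def)
  show "C \<subseteq> \<Omega>" "C \<noteq> {}"
    using y Q.one_closed by (auto simp: C)
  have closed: "act r x \<in> C" if "r \<in> carrier Q" "x \<in> C" for r x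
    using that y by (auto simp: C) (metis act_mult Q.m_closed)
  show "act r x \<in> C \<longleftrightarrow> x \<in> C" if "r \<in> carrier Q" "x \<in> \<Omega>" for r x
    using that closed[of r x] closed[of "inv\<^bsub>Q\<^esub> r" "act r x"] by auto
qed

text \<open>Otherwise there are a finite orbit C and some d \<noteq> 1 with finite class. Take the
  function with value d on C and 1 elsewhere: translations fix it, and pointwise conjugation keeps
  its values on C in the class of d, leaving finitely many possibilities.\<close>

lemma icc_or_infinite_orbits_if_icc:
  assumes "icc W"
  shows "icc D \<or> (\<forall>C \<in> orbits Q \<Omega> act. infinite C)"
proof (rule ccontr)
  assume "\<not> ?thesis"
  then obtain C d where C: "C \<in> orbits Q \<Omega> act" "finite C"
    and d: "d \<in> carrier D" "finite (conj_class D d)" "d \<noteq> \<one>\<^bsub>D\<^esub>"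
    by (auto simp: icc_D_iff)
  note orb = orbit_memD[OF C(1)]
  define ext where "ext = (\<lambda>f. \<lambda>x\<in>\<Omega>. if x \<in> C then f x else \<one>\<^bsub>D\<^esub>)"
  let ?F = "ext ` (C \<rightarrow>\<^sub>E conj_class D d)"
  let ?\<phi> = "ext (\<lambda>x. d)"
  have mem: "?\<phi> \<in> \<Omega> \<rightarrow>\<^sub>E carrier D"
    using d by (auto simp: ext_def)
  have "conj_fun \<psi> r ?\<phi> \<one>\<^bsub>Q\<^esub> \<in> ?F" if \<psi>: "\<psi> \<in> \<Omega> \<rightarrow>\<^sub>E carrier D" and r: "r \<in> carrier Q" for \<psi> r
  proof (rule image_eqI)
    show "(\<lambda>x\<in>C. \<psi> x \<otimes>\<^bsub>D\<^esub> d \<otimes>\<^bsub>D\<^esub> inv\<^bsub>D\<^esub> \<psi> x) \<in> C \<rightarrow>\<^sub>E conj_class D d"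
      using \<psi> orb(1) by (auto simp: conj_class_def)
    show "conj_fun \<psi> r ?\<phi> \<one>\<^bsub>Q\<^esub> = ext (\<lambda>x\<in>C. \<psi> x \<otimes>\<^bsub>D\<^esub> d \<otimes>\<^bsub>D\<^esub> inv\<^bsub>D\<^esub> \<psi> x)"
      unfolding conj_fun_def ext_def
      using \<psi> r orb(3)[of "inv\<^bsub>Q\<^esub> r"] by (fastforce intro!: restrict_ext)
  qed
  then have "conj_class W (?\<phi>, \<one>\<^bsub>Q\<^esub>) \<subseteq> ?F \<times> {\<one>\<^bsub>Q\<^esub>}"
    by (auto simp: conj_class_W[OF mem])
  moreover have "finite (?F \<times> {\<one>\<^bsub>Q\<^esub>})"
    using C(2) d(2) by (intro finite_cartesian_product finite_imageI finite_PiE) auto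
  ultimately have "(?\<phi>, \<one>\<^bsub>Q\<^esub>) = \<one>\<^bsub>W\<^esub>"
    using assms mem by (auto simp: icc_W_iff carrier_W dest: finite_subset)
  then show False
    using orb(1,2) d(3) by (auto simp: one_W ext_def fun_eq_iff subset_iff split: if_splits)
qed

section \<open>Sufficiency of the conditions\<close>

lemma finite_orbit_if_locally_changed:
  assumes fin: "finite (conj_class W g)" and g: "g \<in> carrier W" and h: "h \<in> conj_class W g"
    and S: "finite {x \<in> \<Omega>. fst g x \<noteq> fst h x}" and x0: "x0 \<in> \<Omega>" "fst g x0 \<noteq> fst h x0"
  shows "orbit Q act x0 \<in> orbits Q \<Omega> act" "finite (orbit Q act x0)"
proof -
  show "orbit Q act x0 \<in> orbits Q \<Omega> act"
    using x0 by (auto simp: orbits_def)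
  define diff :: "(('x \<Rightarrow> 'd) \<times> 'q) \<times> (('x \<Rightarrow> 'd) \<times> 'q) \<Rightarrow> 'x set"
    where "diff = (\<lambda>(a, b). {x \<in> \<Omega>. fst a x \<noteq> fst b x})"
  \<comment> \<open>Only pairs with a finite difference set are kept, so that the union over
    \<open>?K\<close> is a finite union of finite sets; it will contain the orbit.\<close>
  let ?K = "{p \<in> conj_class W g \<times> conj_class W g. finite (diff p)}"
  have "act r x0 \<in> \<Union> (diff ` ?K)" if r: "r \<in> carrier Q" for r
  proof -
    let ?\<rho> = "((\<lambda>x\<in>\<Omega>. \<one>\<^bsub>D\<^esub>), r)"
    let ?c = "\<lambda>a. ?\<rho> \<otimes>\<^bsub>W\<^esub> a \<otimes>\<^bsub>W\<^esub> inv\<^bsub>W\<^esub> ?\<rho>"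
    have \<rho>: "?\<rho> \<in> carrier W"
      using r by (auto simp: carrier_W)
    have hW: "h \<in> carrier W"
      using W.conj_class_subset_carrier[OF g] h by auto
    \<comment> \<open>The conjugating function is trivial, so only the translation by r remains,
      whatever the second component of a is. The difference set of the pair is thus moved by
      r.\<close>
    have fst_c: "fst (?c a) x = fst a (act (inv\<^bsub>Q\<^esub> r) x)" if ax: "a \<in> carrier W" "x \<in> \<Omega>" for a x
    proof -
      obtain \<phi> q where a: "a = (\<phi>, q)" "\<phi> \<in> \<Omega> \<rightarrow>\<^sub>E carrier D" "q \<in> carrier Q"
        using ax(1) by (auto simp: carrier_W)
      moreover have "\<phi> (act (inv\<^bsub>Q\<^esub> r) x) \<in> carrier D"
        using a r that by auto
      ultimately show ?thesis
        using r that by (simp add: conj_W conj_fun_def)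
    qed
    have "diff (?c g, ?c h) \<subseteq> act r ` {x \<in> \<Omega>. fst g x \<noteq> fst h x}"
      using r by (auto simp: diff_def fst_c g hW intro!: image_eqI[of _ _ "act (inv\<^bsub>Q\<^esub> r) _"])
    then have "finite (diff (?c g, ?c h))"
      using S finite_subset by blast
    moreover have "act r x0 \<in> diff (?c g, ?c h)"
      using x0 r by (simp add: diff_def fst_c g hW)
    moreover have "?c g \<in> conj_class W g"
      using \<rho> unfolding conj_class_def by blast
    moreover have "?c h \<in> conj_class W g"
      using \<rho> W.conj_class_conj_subset[OF g h] unfolding conj_class_def by blast
    ultimately show ?thesis
      by blast
  qed
  then have "orbit Q act x0 \<subseteq> \<Union> (diff ` ?K)"
    by (auto simp: orbit_def)
  moreover have "finite (\<Union> (diff ` ?K))"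
    using fin by (intro finite_UN_I) auto
  ultimately show "finite (orbit Q act x0)"
    using finite_subset by blast
qed

lemma icc_if_conditions:
  assumes i: "icc D \<or> (\<forall>C \<in> orbits Q \<Omega> act. infinite C)"
    and ii: "{q \<in> FC Q. \<forall>x \<in> \<Omega>. act q x = x} = {\<one>\<^bsub>Q\<^esub>}"
    and iii: "group_center D = {\<one>\<^bsub>D\<^esub>}"
  shows "icc W"
  unfolding icc_W_iff
proof (intro ballI impI, rule ccontr)
  fix g assume g: "g \<in> carrier W" and fin: "finite (conj_class W g)" and ne: "g \<noteq> \<one>\<^bsub>W\<^esub>"
  obtain \<phi> q where gq: "g = (\<phi>, q)" and \<phi>: "\<phi> \<in> \<Omega> \<rightarrow>\<^sub>E carrier D" and q: "q \<in> carrier Q"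
    using g by (auto simp: carrier_W)
  define \<delta> where "\<delta> = (\<lambda>y d. \<lambda>x\<in>\<Omega>. if x = y then d else \<one>\<^bsub>D\<^esub>)"
  have \<delta>: "\<delta> y d \<in> \<Omega> \<rightarrow>\<^sub>E carrier D" if "d \<in> carrier D" for y d
    using that by (auto simp: \<delta>_def)
  define c where "c = (\<lambda>y d. conj_fun (\<delta> y d) \<one>\<^bsub>Q\<^esub> \<phi> q)"
  have c_in: "(c y d, q) \<in> conj_class W g" if "d \<in> carrier D" for y d
    using \<delta>[OF that] q unfolding gq conj_class_W[OF \<phi> q] c_def
    by (fastforce intro: exI[of _ "\<delta> y d"] exI[of _ "\<one>\<^bsub>Q\<^esub>"])
  have c_val: "c y d x = \<delta> y d x \<otimes>\<^bsub>D\<^esub> \<phi> x \<otimes>\<^bsub>D\<^esub> inv\<^bsub>D\<^esub> \<delta> y d (act (inv\<^bsub>Q\<^esub> q) x)"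
    if "x \<in> \<Omega>" for x y d
    using that q by (simp add: c_def conj_fun_def)
  \<comment> \<open>The left factor \<delta>(x) is nontrivial at most at x = y, the right factor at
    most where q^-1 x = y, that is at x = q y.\<close>
  have finite_diff: "finite {x \<in> \<Omega>. fst g x \<noteq> fst (c y d, q) x}" if y: "y \<in> \<Omega>" for y d
  proof (rule finite_subset)
    show "{x \<in> \<Omega>. fst g x \<noteq> fst (c y d, q) x} \<subseteq> {y, act q y}"
    proof (rule ccontr)
      assume "\<not> ?thesis"
      then obtain x where x: "x \<in> \<Omega>" "\<phi> x \<noteq> c y d x" "x \<noteq> y" "x \<noteq> act q y"
        by (auto simp: gq)
      then have "act (inv\<^bsub>Q\<^esub> q) x \<noteq> y"
        using act_inv_act(2)[OF q x(1)] by auto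
      moreover have "\<phi> x \<in> carrier D"
        using \<phi> x by auto
      ultimately show False
        using x q by (simp add: c_val \<delta>_def)
    qed
  qed auto
  \<comment> \<open>Condition (i) is used only here: a changed value at y makes the orbit of y
    finite, which (i) allows only if \<open>D\<close> is icc. Both cases below refute the
    latter.\<close>
  have change: False
    if y: "y \<in> \<Omega>" and d: "d \<in> carrier D" "c y d y \<noteq> \<phi> y" and not_icc: "\<not> icc D" for y d
    using finite_orbit_if_locally_changed[OF fin g c_in[OF d(1), of y] finite_diff[OF y] y] d not_icc i
    by (auto simp: gq)
  have fin_val: "finite ((\<lambda>d. c y d y) ` carrier D)" for y
  proof (rule finite_subset)
    show "(\<lambda>d. c y d y) ` carrier D \<subseteq> (\<lambda>h. fst h y) ` conj_class W g"
      using c_in by force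
  qed (use fin in auto)
  have "conj_class Q q \<subseteq> snd ` conj_class W g"
  proof
    fix p assume "p \<in> conj_class Q q"
    then obtain r where r: "r \<in> carrier Q" "p = r \<otimes>\<^bsub>Q\<^esub> q \<otimes>\<^bsub>Q\<^esub> inv\<^bsub>Q\<^esub> r"
      by (auto simp: conj_class_def)
    \<comment> \<open>The second component depends on r alone, so any function can accompany r;
      \<phi> is simply one at hand.\<close>
    then have "(conj_fun \<phi> r \<phi> q, p) \<in> conj_class W g"
      using \<phi> unfolding gq conj_class_W[OF \<phi> q] by blast
    then show "p \<in> snd ` conj_class W g"
      by force
  qed
  then have FC: "q \<in> FC Q"
    using fin q by (auto simp: Q.mem_FC_iff intro: finite_subset)
  show False
  proof (cases "\<exists>y\<in>\<Omega>. act q y \<noteq> y")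
    case True
    then obtain y where y: "y \<in> \<Omega>" "act q y \<noteq> y" by auto
    have \<phi>y: "\<phi> y \<in> carrier D"
      using \<phi> y by auto
    have "act (inv\<^bsub>Q\<^esub> q) y \<noteq> y"
      using y act_inv_act(2)[OF q y(1)] by metis
    \<comment> \<open>Since q moves y, the right factor is trivial at y. The values d \<phi>(y) are
      pairwise distinct, so \<open>D\<close> is finite and hence not icc, and every d \<noteq> 1
      changes the value.\<close>
    then have cy: "c y d y = d \<otimes>\<^bsub>D\<^esub> \<phi> y" if "d \<in> carrier D" for d
      using that y q \<phi>y by (simp add: c_val \<delta>_def)
    have "inj_on (\<lambda>d. c y d y) (carrier D)"
      using \<phi>y by (auto intro!: inj_onI simp: cy)
    then have "finite (carrier D)"
      using fin_val finite_imageD by blast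
    then have "\<not> icc D"
      by (simp add: icc_def)
    moreover obtain d where d: "d \<in> carrier D" "d \<noteq> \<one>\<^bsub>D\<^esub>"
      using D_nontrivial D.one_closed by blast
    moreover have "c y d y \<noteq> \<phi> y"
      using d \<phi>y by (simp add: cy D.l_cancel_one)
    ultimately show False
      using change y(1) by blast
  next
    case False
    with FC ii have q1: "q = \<one>\<^bsub>Q\<^esub>"
      by blast
    have "\<exists>y\<in>\<Omega>. \<phi> y \<noteq> \<one>\<^bsub>D\<^esub>"
    proof (rule ccontr)
      assume "\<not> ?thesis"
      then have "\<phi> = (\<lambda>x\<in>\<Omega>. \<one>\<^bsub>D\<^esub>)"
        using \<phi> by (intro ext) (auto simp: PiE_iff extensional_def)
      then show False
        using ne by (simp add: gq q1 one_W)
    qed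
    then obtain y where y: "y \<in> \<Omega>" "\<phi> y \<noteq> \<one>\<^bsub>D\<^esub>" by auto
    have \<phi>y: "\<phi> y \<in> carrier D"
      using \<phi> y by auto
    \<comment> \<open>With q = 1 both factors act at y, so the values there run through the whole
      class of \<phi>(y), which is thus finite. Condition (iii) then supplies a d that does not
      commute with \<phi>(y).\<close>
    have cy: "c y d y = d \<otimes>\<^bsub>D\<^esub> \<phi> y \<otimes>\<^bsub>D\<^esub> inv\<^bsub>D\<^esub> d" for d
      using y by (simp add: c_val \<delta>_def q1)
    have "conj_class D (\<phi> y) = (\<lambda>d. c y d y) ` carrier D"
      by (auto simp: cy conj_class_def)
    then have "finite (conj_class D (\<phi> y))"
      using fin_val by simp
    then have "\<not> icc D"
      using \<phi>y y by (auto simp: icc_D_iff)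
    moreover have "\<phi> y \<notin> group_center D"
      using iii y by auto
    then obtain d where d: "d \<in> carrier D" "\<phi> y \<otimes>\<^bsub>D\<^esub> d \<noteq> d \<otimes>\<^bsub>D\<^esub> \<phi> y"
      using \<phi>y by (auto simp: group_center_def)
    moreover have "c y d y \<noteq> \<phi> y"
      using d \<phi>y by (metis cy D.inv_solve_right' D.m_closed)
    ultimately show False
      using change y(1) by blast
  qed
qed

end

theorem theorem4p3:
  fixes D :: "('d, 'm) monoid_scheme"
    and Q :: "('q, 'n) monoid_scheme"
    and \<Omega> :: "'x set"
    and act :: "'q \<Rightarrow> 'x \<Rightarrow> 'x"
  assumes "group D" and "carrier D \<noteq> {\<one>\<^bsub>D\<^esub>}"
    and "group Q"
    and "group_action Q \<Omega> act" and "\<Omega> \<noteq> {}"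
  shows "icc (complete_wreath_product D Q \<Omega> act) \<longleftrightarrow>
    (icc D \<or> (\<forall>C \<in> orbits Q \<Omega> act. infinite C))
    \<and> {q \<in> FC Q. \<forall>x \<in> \<Omega>. act q x = x} = {\<one>\<^bsub>Q\<^esub>}
    \<and> group_center D = {\<one>\<^bsub>D\<^esub>}"
proof -
  interpret wreath_setting D Q \<Omega> act
    using assms by (simp add: wreath_setting_def wreath_setting_axioms_def)
  show ?thesis
    using icc_or_infinite_orbits_if_icc FC_kernel_trivial_if_icc center_trivial_if_icc
      icc_if_conditions by blast
qed

end
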